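(* Let $q\ge2$, let $M^q=(M^q_p)_{p\in\mathbb{N}}$ with $M^q_p:=q^{p^2}$, and let $c>0$. Then the solid hull of $H^{\infty}_{v_{M^q,c}}(\mathbb{C})$ is $$S(H^{\infty}_{v_{M^q,c}}(\mathbb{C}))=\left\{(b_j)_{j\in\mathbb{N}}\in\mathbb{C}^{\mathbb{N}}:\ \sup_{j\ge1}q^{-2j(2j-1)}\left(\sum_{2j\le l\le 2j+1}|b_l|^2\left(\frac{q^{4j-1}}{c}\right)^{2l}\right)^{1/2}<+\infty\right\},$$ or equivalently $$S(H^{\infty}_{v_{M^q,c}}(\mathbb{C}))=\left\{(b_j)_{j\in\mathbb{N}}\in\mathbb{C}^{\mathbb{N}}:\ \exists D\ge1\ \forall j\ge1:\ |b_{2j}|^2+|b_{2j+1}|^2\frac{q^{2(4j-1)}}{c^2}\le D^2c^{4j}q^{-8j^2}\right\}.$$ Moreover, the solid core is $$s(H^{\infty}_{v_{M^q,c}}(\mathbb{C}))=\left\{(b_j)_{j\in\mathbb{N}}\in\mathbb{C}^{\mathbb{N}}:\ \exists D\ge1\ \forall j\ge1:\ |b_{2j}|+|b_{2j+1}|\frac{q^{4j-1}}{c}\le Dc^{2j}q^{-4j^2}\right\}.$$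
   Context: $\mathbb{N}=\{0,1,2,\dots\}$. For a sequence $M=(M_p)_{p\in\mathbb{N}}$ of positive reals with $M_0=1$, the associated weight function is $\omega_M(t):=\sup_{p\in\mathbb{N}}\log(t^p/M_p)$ for $t>0$, $\omega_M(0):=0$. For $c>0$ set $v_{M,c}(r):=\exp(-\omega_M(cr))$, $r\ge0$, and $H^{\infty}_{v_{M,c}}(\mathbb{C}):=\{f \text{ entire}:\ \sup_{z\in\mathbb{C}}|f(z)|v_{M,c}(|z|)<+\infty\}$; an entire function $f(z)=\sum_{j\ge0}a_jz^j$ is identified with its sequence of Taylor coefficients $(a_j)_{j\in\mathbb{N}}$. A vector space $A$ of complex sequences is solid if $(a_j)_j\in A$ and $|b_j|\le|a_j|$ for all $j$ imply $(b_j)_j\in A$. The solid hull is $S(A)=\{(b_j)_j:\exists (a_j)_j\in A,\ |b_j|\le|a_j|\ \forall j\}$ (smallest solid superspace) and the solid core is $s(A)=\{(b_j)_j:(b_j\lambda_j)_j\in A\ \forall(\lambda_j)_j\in\ell^\infty\}$ (largest solid subspace). *)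

theory Defs
  imports "HOL-Complex_Analysis.Complex_Analysis"
begin

text \<open>
  The supremum is taken in the reals, so \<open>assoc_weight M t\<close> is meaningful only when the
  set of values is bounded above; \<open>bdd_above_assoc_weight_q\<close> below shows that this holds
  for \<open>M p = q ^ p\<^sup>2\<close> with \<open>q > 1\<close>.
\<close>

definition assoc_weight :: "(nat \<Rightarrow> real) \<Rightarrow> real \<Rightarrow> real" where
  "assoc_weight M t = (if t = 0 then 0 else (SUP p. ln (t ^ p / M p)))"

definition weight :: "(nat \<Rightarrow> real) \<Rightarrow> real \<Rightarrow> real \<Rightarrow> real" where
  "weight M c r = exp (- assoc_weight M (c * r))"

definition H_inf :: "(real \<Rightarrow> real) \<Rightarrow> (complex \<Rightarrow> complex) set" where
  "H_inf v = {f. f holomorphic_on UNIV \<and> bdd_above (range (\<lambda>z. norm (f z) * v (norm z)))}"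

definition coeff_space :: "(complex \<Rightarrow> complex) set \<Rightarrow> (nat \<Rightarrow> complex) set" where
  "coeff_space F = (\<lambda>f. fps_nth (fps_expansion f 0)) ` F"

definition solid_hull :: "(nat \<Rightarrow> complex) set \<Rightarrow> (nat \<Rightarrow> complex) set" where
  "solid_hull A = {b. \<exists>a\<in>A. \<forall>j. norm (b j) \<le> norm (a j)}"

definition solid_core :: "(nat \<Rightarrow> complex) set \<Rightarrow> (nat \<Rightarrow> complex) set" where
  "solid_core A =
    {b. \<forall>\<mu> :: nat \<Rightarrow> complex. bounded (range \<mu>) \<longrightarrow> (\<lambda>j. b j * \<mu> j) \<in> A}"

definition Mq :: "real \<Rightarrow> nat \<Rightarrow> real" where
  "Mq q p = q ^ (p\<^sup>2)"

lemma bdd_above_assoc_weight_q: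
  assumes q: "q > 1" and t: "t > 0"
  shows "bdd_above (range (\<lambda>p. ln (t ^ p / Mq q p)))"
proof (rule bdd_aboveI2)
  fix p :: nat
  have lq: "ln q > 0" using q by simp
  have "0 \<le> (2 * real p * ln q - ln t)\<^sup>2" by simp
  then have "real p * ln t - (real p)\<^sup>2 * ln q \<le> (ln t)\<^sup>2 / (4 * ln q)"
    using lq by (simp add: field_simps power2_eq_square)
  moreover have "ln (t ^ p / Mq q p) = real p * ln t - (real p)\<^sup>2 * ln q"
    using q t by (simp add: Mq_def ln_div ln_realpow)
  ultimately show "ln (t ^ p / Mq q p) \<le> (ln t)\<^sup>2 / (4 * ln q)"
    by simp
qed

end

theory Submission imports Defs begin

text \<open>
  For a function \<open>f\<close> dominated by \<open>exp (assoc_weight M (c * norm z))\<close> Cauchy's inequality bounds the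
  Taylor coefficients by \<open>C * c ^ j * (INF t. (SUP p. t ^ p / M p) / t ^ j)\<close>. For \<open>M p = q ^ p\<^sup>2\<close>,
  which is log-convex, this infimum is \<open>1 / M j\<close>, attained at \<open>t = q ^ (2 * j)\<close>. The point is that this
  necessary condition is also sufficient: since \<open>M\<close> grows so fast, the terms of the series
  \<open>\<Sum>j. t ^ j / q ^ j\<^sup>2\<close> (a partial theta series) fall off geometrically on both sides of the largest
  one, uniformly in \<open>t\<close>, so the whole series is comparable to its largest term, and that term is
  \<open>exp (assoc_weight M t)\<close>. Hence (lemma \<open>coeff_space_H_inf_Mq\<close>) the coefficient space is
  exactly the weighted sup-norm space of all \<open>a\<close> with \<open>a j = O(c ^ j / q ^ j\<^sup>2)\<close>.

  Such a space is solid, so it equals both its solid hull and its solid core. It remains to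
  rewrite the growth condition blockwise. Grouping the indices \<open>2 * j\<close> and \<open>2 * j + 1\<close> and scaling the
  two entries to \<open>x j = norm (b (2 * j)) / w j\<close> and
  \<open>y j = norm (b (2 * j + 1)) * (q ^ (4 * j - 1) / c) / w j\<close> with \<open>w j = c ^ (2 * j) / q ^ (4 * j\<^sup>2)\<close>, the
  growth condition says that \<open>x\<close> and \<open>y\<close> are bounded (lemma \<open>decay_iff_block_bounded\<close>), and the three
  conditions of the theorem bound \<open>sqrt (x\<^sup>2 + y\<^sup>2)\<close>, \<open>x\<^sup>2 + y\<^sup>2\<close> and \<open>x + y\<close>.
\<close>

section \<open>The theta series and its largest term\<close>

lemma le_exp_assoc_weight_Mq:
  assumes "q > 1" and "t > 0"
  shows "t ^ p / Mq q p \<le> exp (assoc_weight (Mq q) t)"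
proof -
  have "ln (t ^ p / Mq q p) \<le> assoc_weight (Mq q) t"
    using cSUP_upper[OF _ bdd_above_assoc_weight_q[OF assms], of p] assms
    by (simp add: assoc_weight_def)
  moreover have "t ^ p / Mq q p > 0" using assms by (simp add: Mq_def)
  ultimately show ?thesis by (metis exp_le_cancel_iff exp_ln)
qed

text \<open>At \<open>t = q ^ (2 * j)\<close> the term with index \<open>j\<close> is the largest, because \<open>2 * j * p - p\<^sup>2 \<le> j\<^sup>2\<close>.\<close>

lemma exp_assoc_weight_Mq_power_le:
  assumes "q > 1"
  shows "exp (assoc_weight (Mq q) (q ^ (2 * j))) \<le> q ^ j\<^sup>2"
proof -
  have "assoc_weight (Mq q) (q ^ (2 * j)) = (SUP p. ln ((q ^ (2 * j)) ^ p / Mq q p))"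
    using assms by (simp add: assoc_weight_def)
  also have "\<dots> \<le> ln (q ^ j\<^sup>2)"
  proof (rule cSUP_least)
    fix p :: nat
    have "0 \<le> (int j - int p)\<^sup>2" by simp
    then have "int (2 * j * p) \<le> int (j\<^sup>2 + p\<^sup>2)"
      by (simp add: power2_eq_square algebra_simps)
    then have "q ^ (2 * j * p) \<le> q ^ (j\<^sup>2 + p\<^sup>2)"
      using assms by (intro power_increasing) (auto simp only: of_nat_le_iff)
    then have "(q ^ (2 * j)) ^ p / Mq q p \<le> q ^ j\<^sup>2"
      using assms by (simp only: Mq_def power_mult[symmetric] power_add)
        (simp add: pos_divide_le_eq)
    then show "ln ((q ^ (2 * j)) ^ p / Mq q p) \<le> ln (q ^ j\<^sup>2)"
      using assms by (simp add: Mq_def)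
  qed simp
  finally show ?thesis using assms by (simp add: ln_ge_iff)
qed

text \<open>
  Consecutive terms have quotient \<open>t / q ^ (2 * j + 1)\<close>. Let \<open>n\<close> be the first index at which it is at most
  \<open>1\<close>; then \<open>k\<close> steps away from \<open>n\<close>, in either direction, the terms have lost at least a factor
  \<open>q ^ (k\<^sup>2 - k)\<close>, and \<open>k\<^sup>2 - k \<ge> k - 1\<close>. The exponent \<open>(j - n) + (n - j)\<close> is the distance
  of the natural numbers \<open>j\<close> and \<open>n\<close>.
\<close>

lemma Mq_terms_fall_off_from_peak:
  fixes q t :: real
  assumes q: "q > 1" and t: "t > 0"
  obtains n where "\<And>j. t ^ j / Mq q j \<le> t ^ n / Mq q n * (q * (1 / q) ^ ((j - n) + (n - j)))"
proof -
  obtain m where "t < q ^ m" using real_arch_pow[OF q] by blast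
  also have "q ^ m \<le> q ^ (2 * m + 1)" using q by (intro power_increasing) auto
  finally have ex: "\<exists>n. t \<le> q ^ (2 * n + 1)" by (auto intro: less_imp_le)
  define n where "n = (LEAST n. t \<le> q ^ (2 * n + 1))"
  have upper: "t \<le> q ^ (2 * n + 1)" unfolding n_def by (rule LeastI_ex[OF ex])
  have lower: "q ^ (2 * i + 1) \<le> t" if "i < n" for i
    using not_less_Least[of i "\<lambda>n. t \<le> q ^ (2 * n + 1)"] that by (auto simp: n_def)
  have exponent: "2 * k \<le> k\<^sup>2 + 1" for k :: nat
  proof -
    have "0 \<le> (int k - 1)\<^sup>2" by simp
    then have "int (2 * k) \<le> int (k\<^sup>2 + 1)" by (simp add: power2_eq_square algebra_simps)
    then show ?thesis by (simp only: of_nat_le_iff)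
  qed
  show thesis
  proof (rule that[of n])
    fix j
    show "t ^ j / Mq q j \<le> t ^ n / Mq q n * (q * (1 / q) ^ ((j - n) + (n - j)))"
    proof (cases "n \<le> j")
      case True
      then obtain k where j: "j = n + k" using le_Suc_ex by blast
      have "t ^ k * q ^ (k + n\<^sup>2) \<le> (q ^ (2 * n + 1)) ^ k * q ^ (k + n\<^sup>2)"
        using upper q t by (intro mult_right_mono power_mono) auto
      also have "\<dots> = q ^ ((2 * n + 1) * k + (k + n\<^sup>2))"
        by (simp only: power_add power_mult)
      also have "\<dots> \<le> q ^ (1 + j\<^sup>2)"
        using q exponent[of k] by (intro power_increasing) (auto simp: j power2_eq_square algebra_simps)
      finally have "t ^ k * q ^ k * q ^ n\<^sup>2 \<le> q * q ^ j\<^sup>2" by (simp add: power_add mult.assoc)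
      then have "t ^ n * (t ^ k * q ^ k * q ^ n\<^sup>2) \<le> t ^ n * (q * q ^ j\<^sup>2)"
        using t by (intro mult_left_mono) auto
      then have "t ^ j / q ^ j\<^sup>2 \<le> t ^ n / q ^ n\<^sup>2 * (q * (1 / q) ^ k)"
        using q unfolding j by (simp add: field_simps power_add)
      then show ?thesis by (simp add: j Mq_def)
    next
      case False
      then obtain k where n: "n = Suc (j + k)" using less_iff_Suc_add[of j n] by auto
      let ?k = "Suc k"
      have "?k + n\<^sup>2 \<le> (2 * (j + k) + 1) * ?k + (1 + j\<^sup>2)"
        using exponent[of ?k] by (simp add: n power2_eq_square algebra_simps)
      then have "q ^ (?k + n\<^sup>2) \<le> q ^ ((2 * (j + k) + 1) * ?k + (1 + j\<^sup>2))"
        using q by (intro power_increasing) auto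
      also have "\<dots> = (q ^ (2 * (j + k) + 1)) ^ ?k * q ^ (1 + j\<^sup>2)"
        by (simp only: power_add power_mult)
      also have "\<dots> \<le> t ^ ?k * q ^ (1 + j\<^sup>2)"
        using lower[of "j + k"] n q by (intro mult_right_mono power_mono) auto
      finally have "q ^ ?k * q ^ n\<^sup>2 \<le> t ^ ?k * (q * q ^ j\<^sup>2)"
        by (simp only: power_add power_one_right)
      then have "t ^ j * (q ^ ?k * q ^ n\<^sup>2) \<le> t ^ j * (t ^ ?k * (q * q ^ j\<^sup>2))"
        using t by (intro mult_left_mono) auto
      moreover have "t ^ n = t ^ j * t ^ ?k" by (simp add: n power_add)
      ultimately have "t ^ j * (q ^ ?k * q ^ n\<^sup>2) \<le> t ^ n * (q * q ^ j\<^sup>2)"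
        by (simp only: mult.assoc)
      then have "t ^ j / q ^ j\<^sup>2 \<le> t ^ n / q ^ n\<^sup>2 * (q * (1 / q) ^ ?k)"
        using q by (simp add: field_simps del: power_Suc)
      moreover have "(j - n) + (n - j) = ?k" by (simp add: n)
      ultimately show ?thesis by (simp only: Mq_def)
    qed
  qed
qed

lemma two_sided_geometric:
  fixes x :: real
  assumes "0 \<le> x" and "x < 1"
  shows "summable (\<lambda>j. x ^ ((j - n) + (n - j)))"
    and "(\<Sum>j. x ^ ((j - n) + (n - j))) \<le> 2 / (1 - x)"
proof -
  let ?g = "\<lambda>j. x ^ ((j - n) + (n - j))"
  have geo: "summable (\<lambda>k. x ^ k)" and tail: "(\<Sum>k. x ^ k) = 1 / (1 - x)"
    using assms by (auto simp: summable_geometric suminf_geometric)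
  show *: "summable ?g"
    using geo by (subst summable_iff_shift[of _ n, symmetric]) simp
  have "(\<Sum>j<n. ?g j) = (\<Sum>j<n. x ^ Suc (n - Suc j))"
    by (intro sum.cong) (auto simp: Suc_diff_Suc)
  also have "\<dots> = (\<Sum>j<n. x ^ Suc j)" by (rule sum.nat_diff_reindex)
  also have "\<dots> \<le> (\<Sum>j<n. x ^ j)" using assms by (intro sum_mono) (auto intro: mult_left_le_one_le)
  also have "\<dots> \<le> 1 / (1 - x)"
    unfolding tail[symmetric] using assms by (intro sum_le_suminf geo) auto
  finally show "suminf ?g \<le> 2 / (1 - x)"
    by (subst suminf_split_initial_segment[OF *, of n]) (simp add: tail)
qed

lemma theta_series_le_exp_assoc_weight:
  assumes q: "q > 1" and t: "t \<ge> 0"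
  shows "summable (\<lambda>j. t ^ j / Mq q j)"
    and "(\<Sum>j. t ^ j / Mq q j) \<le> 2 * q / (1 - 1 / q) * exp (assoc_weight (Mq q) t)"
proof -
  have "summable (\<lambda>j. t ^ j / Mq q j) \<and>
    (\<Sum>j. t ^ j / Mq q j) \<le> 2 * q / (1 - 1 / q) * exp (assoc_weight (Mq q) t)"
  proof (cases "t = 0")
    case True
    \<comment> \<open>Here \<open>assoc_weight\<close> has its default value \<open>0\<close>, and only the term \<open>0 ^ 0 = 1\<close> is left.\<close>
    have "(\<lambda>j. t ^ j / Mq q j) = (\<lambda>j. if j = 0 then 1 else 0)"
      by (auto simp: True Mq_def)
    moreover have "(1::real) \<le> 2 * q / (1 - 1 / q)"
      using q by (simp add: field_simps) (smt (verit) mult_less_cancel_left2)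
    ultimately show ?thesis
      using sums_single[of 0 "\<lambda>_. 1::real"] by (simp add: True assoc_weight_def sums_iff)
  next
    case False
    with t have t: "t > 0" by simp
    let ?S = "exp (assoc_weight (Mq q) t)"
    obtain n where n: "\<And>j. t ^ j / Mq q j \<le> t ^ n / Mq q n * (q * (1 / q) ^ ((j - n) + (n - j)))"
      using Mq_terms_fall_off_from_peak[OF q t] by blast
    let ?g = "\<lambda>j. (1 / q) ^ ((j - n) + (n - j))"
    have x: "0 \<le> 1 / q" "1 / q < 1" using q by auto
    have le: "t ^ j / Mq q j \<le> ?S * q * ?g j" for j
    proof -
      have "t ^ n / Mq q n * (q * ?g j) \<le> ?S * (q * ?g j)"
        using q by (intro mult_right_mono le_exp_assoc_weight_Mq t) auto
      with n[of j] show ?thesis by (simp add: mult.assoc)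
    qed
    have sg: "summable (\<lambda>j. ?S * q * ?g j)"
      by (intro summable_mult two_sided_geometric(1) x)
    have su: "summable (\<lambda>j. t ^ j / Mq q j)"
      using le q t by (intro summable_comparison_test'[OF sg, of 0]) (auto simp: Mq_def)
    have "(\<Sum>j. t ^ j / Mq q j) \<le> (\<Sum>j. ?S * q * ?g j)"
      by (intro suminf_le le su sg)
    also have "\<dots> = ?S * q * suminf ?g"
      by (intro suminf_mult two_sided_geometric(1) x)
    also have "\<dots> \<le> ?S * q * (2 / (1 - 1 / q))"
      using q by (intro mult_left_mono two_sided_geometric(2) x) auto
    finally show ?thesis using su by (simp add: mult_ac)
  qed
  then show "summable (\<lambda>j. t ^ j / Mq q j)"
    and "(\<Sum>j. t ^ j / Mq q j) \<le> 2 * q / (1 - 1 / q) * exp (assoc_weight (Mq q) t)" by auto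
qed

section \<open>The coefficient space\<close>

text \<open>Cauchy's inequality on the circle of radius \<open>q ^ (2 * j) / c\<close>, which is optimal for index \<open>j\<close>.\<close>

lemma coeff_bound_H_inf_Mq:
  assumes q: "q > 1" and c: "c > 0" and f: "f \<in> H_inf (weight (Mq q) c)"
  shows "\<exists>C. \<forall>j. norm (fps_nth (fps_expansion f 0) j) \<le> C * c ^ j / Mq q j"
proof -
  have hol: "f holomorphic_on UNIV" using f by (simp add: H_inf_def)
  obtain C where C: "\<And>z. norm (f z) * weight (Mq q) c (norm z) \<le> C"
    using f by (auto simp: H_inf_def bdd_above_def)
  have "0 \<le> C" using C[of 0] by (simp add: weight_def order_trans[rotated])
  have "norm (fps_nth (fps_expansion f 0) j) \<le> C * c ^ j / Mq q j" for j
  proof -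
    define r where "r = q ^ (2 * j) / c"
    have "norm ((deriv ^^ j) f 0) \<le> fact j * (C * q ^ j\<^sup>2) / r ^ j"
    proof (rule Cauchy_inequality)
      show "f holomorphic_on ball 0 r" "continuous_on (cball 0 r) f"
        using hol by (auto intro: holomorphic_on_subset holomorphic_on_imp_continuous_on)
      show "0 < r" using q c by (simp add: r_def)
      fix z :: complex assume "norm (0 - z) = r"
      then have "c * norm z = q ^ (2 * j)" using c by (simp add: r_def)
      then have "norm (f z) \<le> C * exp (assoc_weight (Mq q) (q ^ (2 * j)))"
        using C[of z] by (simp add: weight_def exp_minus field_simps)
      also have "\<dots> \<le> C * q ^ j\<^sup>2"
        using \<open>0 \<le> C\<close> by (intro mult_left_mono exp_assoc_weight_Mq_power_le q)
      finally show "norm (f z) \<le> C * q ^ j\<^sup>2" .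
    qed
    then have "norm (fps_nth (fps_expansion f 0) j) \<le> C * q ^ j\<^sup>2 / r ^ j"
      by (simp add: fps_expansion_def norm_divide field_simps)
    also have "r ^ j = q ^ j\<^sup>2 * q ^ j\<^sup>2 / c ^ j"
      by (simp add: r_def power_divide power2_eq_square mult_2 flip: power_mult power_add)
         (simp add: algebra_simps)
    finally show ?thesis using q c by (simp add: Mq_def)
  qed
  then show ?thesis by blast
qed

lemma decay_imp_coeff_of_H_inf_Mq:
  assumes q: "q > 1" and c: "c > 0" and C: "\<And>j. norm (a j) \<le> C * c ^ j / Mq q j"
  shows "\<exists>f\<in>H_inf (weight (Mq q) c). fps_nth (fps_expansion f 0) = a"
proof
  let ?f = "eval_fps (Abs_fps a)"
  let ?K = "2 * q / (1 - 1 / q)"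
  have "0 \<le> C" using order_trans[OF norm_ge_zero C[of 0]] by (simp add: Mq_def)
  have term_le: "norm (a j * z ^ j) \<le> C * ((c * norm z) ^ j / Mq q j)" for j z
    using mult_right_mono[OF C[of j], of "norm z ^ j"]
    by (simp add: norm_mult norm_power power_mult_distrib mult_ac)
  have major: "summable (\<lambda>j. C * ((c * norm z) ^ j / Mq q j))" for z :: complex
    using c by (intro summable_mult theta_series_le_exp_assoc_weight q) auto
  have abs: "summable (\<lambda>j. norm (a j * z ^ j))" for z
    using term_le by (intro summable_comparison_test'[OF major, of 0]) auto
  have R: "fps_conv_radius (Abs_fps a) = \<infinity>"
    unfolding fps_conv_radius_def
    using abs by (intro conv_radius_inftyI'') (auto intro: summable_norm_cancel)
  have hol: "?f holomorphic_on UNIV" by (rule holomorphic_on_eval_fps) (auto simp: R)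
  have "?f has_fps_expansion Abs_fps a" by (simp add: has_fps_expansion_def R)
  then show "fps_nth (fps_expansion ?f 0) = a"
    by (auto simp: fps_expansion_def fun_eq_iff dest: fps_nth_fps_expansion[symmetric])
  have "norm (?f z) * weight (Mq q) c (norm z) \<le> C * ?K" for z
  proof -
    have "norm (?f z) \<le> (\<Sum>j. norm (a j * z ^ j))"
      unfolding eval_fps_def using summable_norm[OF abs] by simp
    also have "\<dots> \<le> (\<Sum>j. C * ((c * norm z) ^ j / Mq q j))"
      by (intro suminf_le term_le abs major)
    also have "\<dots> = C * (\<Sum>j. (c * norm z) ^ j / Mq q j)"
      using c by (intro suminf_mult theta_series_le_exp_assoc_weight q) auto
    also have "\<dots> \<le> C * (?K * exp (assoc_weight (Mq q) (c * norm z)))"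
      using c \<open>0 \<le> C\<close> by (intro mult_left_mono theta_series_le_exp_assoc_weight q) auto
    finally show ?thesis by (simp add: weight_def exp_minus divide_le_eq mult.assoc flip: divide_inverse)
  qed
  then have "bdd_above (range (\<lambda>z. norm (?f z) * weight (Mq q) c (norm z)))"
    by (rule bdd_aboveI2)
  with hol show "?f \<in> H_inf (weight (Mq q) c)" by (simp add: H_inf_def)
qed

lemma coeff_space_H_inf_Mq:
  assumes "q > 1" and "c > 0"
  shows "coeff_space (H_inf (weight (Mq q) c)) = {a. \<exists>C. \<forall>j. norm (a j) \<le> C * c ^ j / Mq q j}"
proof (intro set_eqI iffI)
  fix a assume "a \<in> coeff_space (H_inf (weight (Mq q) c))"
  then obtain f where "f \<in> H_inf (weight (Mq q) c)" "a = fps_nth (fps_expansion f 0)"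
    by (auto simp: coeff_space_def)
  then show "a \<in> {a. \<exists>C. \<forall>j. norm (a j) \<le> C * c ^ j / Mq q j}"
    using coeff_bound_H_inf_Mq[OF assms] by simp
next
  fix a :: "nat \<Rightarrow> complex"
  assume "a \<in> {a. \<exists>C. \<forall>j. norm (a j) \<le> C * c ^ j / Mq q j}"
  then obtain C where "\<And>j. norm (a j) \<le> C * c ^ j / Mq q j" by blast
  from decay_imp_coeff_of_H_inf_Mq[OF assms this]
  show "a \<in> coeff_space (H_inf (weight (Mq q) c))" by (auto simp: coeff_space_def)
qed

text \<open>
  Shrinking the moduli keeps the bound, and a bounded multiplier only changes the constant;
  conversely the constant multiplier \<open>1\<close> shows that the core is contained in the space.
\<close>

lemma solid_hull_core_decay:
  fixes m :: "nat \<Rightarrow> real"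
  defines "A \<equiv> {a :: nat \<Rightarrow> complex. \<exists>C. \<forall>j. norm (a j) \<le> C * m j}"
  shows "solid_hull A = A" and "solid_core A = A"
proof -
  show "solid_hull A = A"
  proof
    show "A \<subseteq> solid_hull A" by (auto simp: solid_hull_def)
    show "solid_hull A \<subseteq> A"
    proof
      fix b assume "b \<in> solid_hull A"
      then obtain a :: "nat \<Rightarrow> complex" and C
        where "\<forall>j. norm (b j) \<le> norm (a j)" "\<forall>j. norm (a j) \<le> C * m j"
        unfolding solid_hull_def A_def by blast
      then have "\<And>j. norm (b j) \<le> C * m j" by (blast intro: order_trans)
      then show "b \<in> A" by (auto simp: A_def)
    qed
  qed
  show "solid_core A = A"
  proof
    show "solid_core A \<subseteq> A"
    proof
      fix b assume "b \<in> solid_core A"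
      moreover have "bounded (range (\<lambda>_::nat. 1::complex))" by simp
      ultimately have "(\<lambda>j. b j * 1) \<in> A" unfolding solid_core_def by blast
      then show "b \<in> A" by simp
    qed
    show "A \<subseteq> solid_core A"
    proof
      fix b assume "b \<in> A"
      then obtain C where C: "\<And>j. norm (b j) \<le> C * m j" by (auto simp: A_def)
      have "(\<lambda>j. b j * \<mu> j) \<in> A" if \<mu>: "bounded (range \<mu>)" for \<mu> :: "nat \<Rightarrow> complex"
      proof -
        obtain K where K: "\<And>j. norm (\<mu> j) \<le> K" using \<mu> unfolding bounded_iff by blast
        have "norm (b j * \<mu> j) \<le> (C * K) * m j" for j
          using mult_mono[OF C[of j] K[of j]] order_trans[OF norm_ge_zero C[of j]]
          by (simp add: norm_mult mult_ac)
        then show ?thesis by (auto simp: A_def)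
      qed
      then show "b \<in> solid_core A" by (simp add: solid_core_def)
    qed
  qed
qed

section \<open>Blocks of two coefficients\<close>

definition block_weight :: "real \<Rightarrow> real \<Rightarrow> nat \<Rightarrow> real" where
  "block_weight q c j = c ^ (2 * j) * q powi (- (4 * (int j)\<^sup>2))"

lemma block_weight_pos: "q > 0 \<Longrightarrow> c > 0 \<Longrightarrow> block_weight q c j > 0"
  by (simp add: block_weight_def)

lemma block_weight_even: "block_weight q c j = c ^ (2 * j) / Mq q (2 * j)"
  by (simp add: block_weight_def Mq_def power_int_minus divide_inverse power_mult_distrib
      flip: power_int_of_nat)

text \<open>
  The scaling of the odd entry fits the bound \<open>c ^ l / q ^ l\<^sup>2\<close> at \<open>l = 2 * j + 1\<close> up to the constant
  factor \<open>q\<^sup>2\<close>, since \<open>(2 * j + 1)\<^sup>2 = 4 * j\<^sup>2 + (4 * j - 1) + 2\<close>.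
\<close>

lemma block_weight_odd:
  assumes "q > 0" and "c > 0" and "j \<ge> 1"
  shows "block_weight q c j / (q ^ (4 * j - 1) / c) = q\<^sup>2 * (c ^ (2 * j + 1) / Mq q (2 * j + 1))"
proof -
  have "(2 * j + 1)\<^sup>2 = (2 * j)\<^sup>2 + (4 * j - 1) + 2"
    using \<open>j \<ge> 1\<close> by (simp add: power2_eq_square algebra_simps)
  then have "Mq q (2 * j + 1) = Mq q (2 * j) * q ^ (4 * j - 1) * q\<^sup>2"
    by (simp only: Mq_def power_add)
  moreover have "Mq q (2 * j) > 0" using assms by (simp add: Mq_def)
  ultimately show ?thesis using assms by (simp add: block_weight_even field_simps)
qed

text \<open>The first two coefficients are not part of any block, but finitely many of them do not matter.\<close>

lemma decay_iff_block_bounded: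
  fixes b :: "nat \<Rightarrow> complex"
  assumes q: "q > 0" and c: "c > 0"
  shows "(\<exists>C. \<forall>l. norm (b l) \<le> C * c ^ l / Mq q l) \<longleftrightarrow>
    (\<exists>C. \<forall>j\<ge>1. norm (b (2 * j)) / block_weight q c j \<le> C \<and>
       norm (b (2 * j + 1)) * (q ^ (4 * j - 1) / c) / block_weight q c j \<le> C)"
    (is "?decay \<longleftrightarrow> ?block")
proof
  have M: "Mq q l > 0" for l using q by (simp add: Mq_def)
  have even: "norm (b (2 * j)) / block_weight q c j \<le> D \<longleftrightarrow>
      norm (b (2 * j)) \<le> D * (c ^ (2 * j) / Mq q (2 * j))" for j D
    using block_weight_pos[OF q c, of j] by (simp add: pos_divide_le_eq flip: block_weight_even)
  have odd: "norm (b (2 * j + 1)) * (q ^ (4 * j - 1) / c) / block_weight q c j \<le> D \<longleftrightarrow>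
      norm (b (2 * j + 1)) \<le> D * q\<^sup>2 * (c ^ (2 * j + 1) / Mq q (2 * j + 1))" if "j \<ge> 1" for j D
  proof -
    have "norm (b (2 * j + 1)) * (q ^ (4 * j - 1) / c) / block_weight q c j \<le> D \<longleftrightarrow>
        norm (b (2 * j + 1)) \<le> D * (block_weight q c j / (q ^ (4 * j - 1) / c))"
      using block_weight_pos[OF q c, of j] q c by (simp add: field_simps)
    then show ?thesis by (simp only: block_weight_odd[OF q c that] mult.assoc)
  qed
  {
    assume ?decay
    then obtain C where C: "\<And>l. norm (b l) \<le> C * (c ^ l / Mq q l)" by auto
    let ?D = "max C (C / q\<^sup>2)"
    have "norm (b (2 * j)) / block_weight q c j \<le> C" for j
      unfolding even by (rule C)
    moreover have "norm (b (2 * j + 1)) * (q ^ (4 * j - 1) / c) / block_weight q c j \<le> C / q\<^sup>2"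
      if "j \<ge> 1" for j
      unfolding odd[OF that] using C[of "2 * j + 1"] q by simp
    ultimately have "\<forall>j\<ge>1. norm (b (2 * j)) / block_weight q c j \<le> ?D \<and>
       norm (b (2 * j + 1)) * (q ^ (4 * j - 1) / c) / block_weight q c j \<le> ?D"
      by (meson max.coboundedI1 max.coboundedI2)
    then show ?block by blast
  }
  {
    assume ?block
    then obtain D where D: "\<And>j. j \<ge> 1 \<Longrightarrow> norm (b (2 * j)) / block_weight q c j \<le> D"
      "\<And>j. j \<ge> 1 \<Longrightarrow> norm (b (2 * j + 1)) * (q ^ (4 * j - 1) / c) / block_weight q c j \<le> D"
      by blast
    define m where "m l = c ^ l / Mq q l" for l
    have m: "m l > 0" for l using M c by (simp add: m_def)
    let ?C = "Max {D, D * q\<^sup>2, norm (b 0) / m 0, norm (b 1) / m 1}"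
    have "norm (b l) / m l \<le> ?C" for l
    proof -
      consider "l = 0" | "l = 1" | j where "j \<ge> 1" "l = 2 * j" | j where "j \<ge> 1" "l = 2 * j + 1"
        by (metis One_nat_def add_0 add_cancel_right_left even_two_times_div_two less_one
            linorder_le_less_linear mult_0_right odd_two_times_div_two_succ)
      then have "norm (b l) / m l \<in> {norm (b 0) / m 0, norm (b 1) / m 1} \<or>
          norm (b l) / m l \<le> D \<or> norm (b l) / m l \<le> D * q\<^sup>2"
      proof cases
        case 3
        have "norm (b l) \<le> D * m l"
          using D(1)[OF 3(1)] unfolding even by (simp add: m_def 3(2))
        then show ?thesis using m[of l] by (simp only: pos_divide_le_eq simp_thms)
      next
        case 4
        have "norm (b l) \<le> D * q\<^sup>2 * m l"
          using D(2)[OF 4(1)] unfolding odd[OF 4(1)] by (simp add: m_def 4(2))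
        then show ?thesis using m[of l] by (simp only: pos_divide_le_eq simp_thms)
      qed auto
      then show ?thesis by (auto simp: le_max_iff_disj)
    qed
    then have "norm (b l) \<le> ?C * c ^ l / Mq q l" for l
      using m[of l] by (metis m_def pos_divide_le_eq times_divide_eq_right)
    then show ?decay by blast
  }
qed

text \<open>
  Bounding both coordinates is the same as bounding any norm on the plane; the lower bound on the
  constant only asks for it to be enlarged.
\<close>

lemma bounded_pairs_iff:
  fixes x y :: "nat \<Rightarrow> real"
  assumes nonneg: "\<And>j. 0 \<le> x j" "\<And>j. 0 \<le> y j"
  shows "(\<exists>C. \<forall>j\<ge>1. x j \<le> C \<and> y j \<le> C) \<longleftrightarrow> (\<exists>D\<ge>1. \<forall>j\<ge>1. x j + y j \<le> D)"
    and "(\<exists>C. \<forall>j\<ge>1. x j \<le> C \<and> y j \<le> C) \<longleftrightarrow> (\<exists>D\<ge>1. \<forall>j\<ge>1. (x j)\<^sup>2 + (y j)\<^sup>2 \<le> D\<^sup>2)"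
    and "(\<exists>C. \<forall>j\<ge>1. x j \<le> C \<and> y j \<le> C) \<longleftrightarrow>
      bdd_above ((\<lambda>j. sqrt ((x j)\<^sup>2 + (y j)\<^sup>2)) ` {1..})"
proof -
  let ?B = "\<exists>C. \<forall>j\<ge>1. x j \<le> C \<and> y j \<le> C"
  have sum: "\<exists>D\<ge>1. \<forall>j\<ge>1. x j + y j \<le> D" if ?B
  proof -
    from that obtain C where C: "\<And>j. j \<ge> 1 \<Longrightarrow> x j \<le> C \<and> y j \<le> C" by blast
    have "x j + y j \<le> max 1 (2 * C)" if "j \<ge> 1" for j using C[OF that] by linarith
    then show ?thesis by (intro exI[of _ "max 1 (2 * C)"]) auto
  qed
  have squares: "\<exists>D\<ge>1. \<forall>j\<ge>1. (x j)\<^sup>2 + (y j)\<^sup>2 \<le> D\<^sup>2" if "\<exists>D\<ge>1. \<forall>j\<ge>1. x j + y j \<le> D"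
  proof -
    from that obtain D where D: "D \<ge> 1" "\<And>j. j \<ge> 1 \<Longrightarrow> x j + y j \<le> D" by blast
    have "(x j)\<^sup>2 + (y j)\<^sup>2 \<le> D\<^sup>2" if "j \<ge> 1" for j
    proof -
      have "(x j)\<^sup>2 + (y j)\<^sup>2 \<le> (x j + y j)\<^sup>2" using nonneg by (simp add: power2_sum)
      also have "\<dots> \<le> D\<^sup>2" using D(2)[OF that] nonneg by (intro power_mono) auto
      finally show ?thesis .
    qed
    with D(1) show ?thesis by blast
  qed
  have root: "bdd_above ((\<lambda>j. sqrt ((x j)\<^sup>2 + (y j)\<^sup>2)) ` {1..})"
    if "\<exists>D\<ge>1. \<forall>j\<ge>1. (x j)\<^sup>2 + (y j)\<^sup>2 \<le> D\<^sup>2"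
  proof -
    from that obtain D where D: "D \<ge> 1" "\<And>j. j \<ge> 1 \<Longrightarrow> (x j)\<^sup>2 + (y j)\<^sup>2 \<le> D\<^sup>2" by blast
    have "sqrt ((x j)\<^sup>2 + (y j)\<^sup>2) \<le> D" if "j \<ge> 1" for j
      using D(1) D(2)[OF that] by (intro real_le_lsqrt) auto
    then show ?thesis by (intro bdd_aboveI2[of _ _ D]) auto
  qed
  have coords: ?B if "bdd_above ((\<lambda>j. sqrt ((x j)\<^sup>2 + (y j)\<^sup>2)) ` {1..})"
  proof -
    from that obtain D where D: "\<And>j. j \<ge> 1 \<Longrightarrow> sqrt ((x j)\<^sup>2 + (y j)\<^sup>2) \<le> D"
      by (auto simp: bdd_above_def)
    have "x j \<le> D \<and> y j \<le> D" if "j \<ge> 1" for j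
      using D[OF that] real_sqrt_sum_squares_ge1[of "x j" "y j"]
        real_sqrt_sum_squares_ge2[of "y j" "x j"] by linarith
    then show ?thesis by blast
  qed
  show "?B \<longleftrightarrow> (\<exists>D\<ge>1. \<forall>j\<ge>1. x j + y j \<le> D)"
    by (rule iffI, erule sum, erule coords[OF root[OF squares]])
  show "?B \<longleftrightarrow> (\<exists>D\<ge>1. \<forall>j\<ge>1. (x j)\<^sup>2 + (y j)\<^sup>2 \<le> D\<^sup>2)"
    by (rule iffI, erule squares[OF sum], erule coords[OF root])
  show "?B \<longleftrightarrow> bdd_above ((\<lambda>j. sqrt ((x j)\<^sup>2 + (y j)\<^sup>2)) ` {1..})"
    by (rule iffI, erule root[OF squares[OF sum]], erule coords)
qed

text \<open>
  The square root releases the factor \<open>(q ^ (4 * j - 1) / c) ^ (2 * j)\<close> common to both summands, and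
  the prefactor reduces it to \<open>1 / block_weight q c j\<close>:
  \<open>2 * j * (4 * j - 1) - 2 * j * (2 * j - 1) = 4 * j\<^sup>2\<close>.
\<close>

lemma block_sqrt_eq:
  fixes b :: "nat \<Rightarrow> complex"
  assumes q: "q > 0" and c: "c > 0" and j: "j \<ge> 1"
  shows "q powi (- (2 * int j * (2 * int j - 1))) *
      sqrt (\<Sum>l = 2 * j..2 * j + 1. (norm (b l))\<^sup>2 * (q ^ (4 * j - 1) / c) ^ (2 * l)) =
    sqrt ((norm (b (2 * j)) / block_weight q c j)\<^sup>2 +
      (norm (b (2 * j + 1)) * (q ^ (4 * j - 1) / c) / block_weight q c j)\<^sup>2)"
proof -
  define s where "s = q ^ (4 * j - 1) / c"
  let ?w = "block_weight q c j"
  have s: "s > 0" and w: "?w > 0" using q c by (simp_all add: s_def block_weight_pos)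
  have "(\<Sum>l = 2 * j..2 * j + 1. (norm (b l))\<^sup>2 * s ^ (2 * l)) =
      (s ^ (2 * j))\<^sup>2 * ((norm (b (2 * j)))\<^sup>2 + (norm (b (2 * j + 1)) * s)\<^sup>2)"
    by (simp add: power_mult_distrib algebra_simps flip: power_mult power_add)
       (simp add: power_add algebra_simps power2_eq_square)
  then have "sqrt (\<Sum>l = 2 * j..2 * j + 1. (norm (b l))\<^sup>2 * s ^ (2 * l)) =
      s ^ (2 * j) * sqrt ((norm (b (2 * j)))\<^sup>2 + (norm (b (2 * j + 1)) * s)\<^sup>2)"
    using s by (simp add: real_sqrt_mult)
  moreover have "q powi (- (2 * int j * (2 * int j - 1))) * s ^ (2 * j) = 1 / ?w"
  proof -
    have "s ^ (2 * j) = q powi (int ((4 * j - 1) * (2 * j))) / c ^ (2 * j)"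
      by (simp only: s_def power_divide power_int_of_nat power_mult)
    moreover have "int ((4 * j - 1) * (2 * j)) = 2 * int j * (2 * int j - 1) + 4 * (int j)\<^sup>2"
    proof -
      have "int (4 * j - 1) = 4 * int j - 1" using j by simp
      then show ?thesis by (simp only: of_nat_mult) (simp add: power2_eq_square algebra_simps)
    qed
    moreover have "q powi (- a) * q powi (a + b) = q powi b" for a b :: int
      using q by (simp flip: power_int_add)
    ultimately have "q powi (- (2 * int j * (2 * int j - 1))) * s ^ (2 * j) =
        q powi (4 * (int j)\<^sup>2) / c ^ (2 * j)"
      by (simp only: times_divide_eq_right)
    then show ?thesis
      by (simp add: block_weight_def power_int_minus divide_inverse)
  qed
  moreover have "sqrt ((norm (b (2 * j)) / ?w)\<^sup>2 + (norm (b (2 * j + 1)) * s / ?w)\<^sup>2) =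
      1 / ?w * sqrt ((norm (b (2 * j)))\<^sup>2 + (norm (b (2 * j + 1)) * s)\<^sup>2)"
    using w by (simp add: power_divide real_sqrt_divide flip: add_divide_distrib)
  ultimately show ?thesis by (simp only: s_def mult.assoc[symmetric])
qed

lemma block_squares_le_iff:
  fixes b :: "nat \<Rightarrow> complex"
  assumes q: "q > 0" and c: "c > 0"
  shows "(norm (b (2 * j)))\<^sup>2 + (norm (b (2 * j + 1)))\<^sup>2 * (q ^ (2 * (4 * j - 1)) / c\<^sup>2)
      \<le> D\<^sup>2 * c ^ (4 * j) * q powi (- (8 * (int j)\<^sup>2)) \<longleftrightarrow>
    (norm (b (2 * j)) / block_weight q c j)\<^sup>2 +
      (norm (b (2 * j + 1)) * (q ^ (4 * j - 1) / c) / block_weight q c j)\<^sup>2 \<le> D\<^sup>2"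
proof -
  let ?w = "block_weight q c j"
  have w: "?w\<^sup>2 > 0" using block_weight_pos[OF q c, of j] by simp
  have "q powi (- (8 * (int j)\<^sup>2)) = (q powi (- (4 * (int j)\<^sup>2)))\<^sup>2"
    using q by (simp add: power2_eq_square flip: power_int_add)
  moreover have "c ^ (4 * j) = (c ^ (2 * j))\<^sup>2" by (simp flip: power_mult)
  ultimately have "D\<^sup>2 * c ^ (4 * j) * q powi (- (8 * (int j)\<^sup>2)) = D\<^sup>2 * ?w\<^sup>2"
    by (simp only: block_weight_def power_mult_distrib mult.assoc)
  moreover have "q ^ (2 * (4 * j - 1)) / c\<^sup>2 = (q ^ (4 * j - 1) / c)\<^sup>2"
    by (simp add: power_divide mult.commute flip: power_mult)
  ultimately show ?thesis
    using w by (simp only: power_divide[of _ ?w] add_divide_distrib[symmetric] pos_divide_le_eq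
        power_mult_distrib)
qed

lemma block_sum_le_iff:
  fixes b :: "nat \<Rightarrow> complex"
  assumes q: "q > 0" and c: "c > 0"
  shows "norm (b (2 * j)) + norm (b (2 * j + 1)) * (q ^ (4 * j - 1) / c)
      \<le> D * c ^ (2 * j) * q powi (- (4 * (int j)\<^sup>2)) \<longleftrightarrow>
    norm (b (2 * j)) / block_weight q c j +
      norm (b (2 * j + 1)) * (q ^ (4 * j - 1) / c) / block_weight q c j \<le> D"
  using block_weight_pos[OF q c, of j]
  by (simp only: add_divide_distrib[symmetric] pos_divide_le_eq) (simp add: block_weight_def mult.assoc)

theorem corollary4p15:
  fixes q c :: real
  assumes "q \<ge> 2" and "c > 0"
  shows "solid_hull (coeff_space (H_inf (weight (Mq q) c))) =
      {b. bdd_above ((\<lambda>j. q powi (- (2 * int j * (2 * int j - 1))) *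
            sqrt (\<Sum>l = 2 * j..2 * j + 1. (norm (b l))\<^sup>2 * (q ^ (4 * j - 1) / c) ^ (2 * l))) ` {1..})}
    \<and> solid_hull (coeff_space (H_inf (weight (Mq q) c))) =
      {b. \<exists>D\<ge>1. \<forall>j\<ge>1. (norm (b (2 * j)))\<^sup>2 + (norm (b (2 * j + 1)))\<^sup>2 * (q ^ (2 * (4 * j - 1)) / c\<^sup>2)
            \<le> D\<^sup>2 * c ^ (4 * j) * q powi (- (8 * (int j)\<^sup>2))}
    \<and> solid_core (coeff_space (H_inf (weight (Mq q) c))) =
      {b. \<exists>D\<ge>1. \<forall>j\<ge>1. norm (b (2 * j)) + norm (b (2 * j + 1)) * (q ^ (4 * j - 1) / c)
            \<le> D * c ^ (2 * j) * q powi (- (4 * (int j)\<^sup>2))}"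
proof -
  have q: "q > 0" "q > 1" using assms by auto
  note c = \<open>c > 0\<close>
  let ?A = "{a :: nat \<Rightarrow> complex. \<exists>C. \<forall>j. norm (a j) \<le> C * c ^ j / Mq q j}"
  have space: "coeff_space (H_inf (weight (Mq q) c)) = ?A"
    by (rule coeff_space_H_inf_Mq[OF q(2) c])
  have solid: "solid_hull ?A = ?A" "solid_core ?A = ?A"
    using solid_hull_core_decay[of "\<lambda>j. c ^ j / Mq q j"] by simp_all
  let ?x = "\<lambda>b :: nat \<Rightarrow> complex. \<lambda>j. norm (b (2 * j)) / block_weight q c j"
  let ?y = "\<lambda>b :: nat \<Rightarrow> complex.
    \<lambda>j. norm (b (2 * j + 1)) * (q ^ (4 * j - 1) / c) / block_weight q c j"
  have nonneg: "0 \<le> ?x b j" "0 \<le> ?y b j" for b j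
    using block_weight_pos[OF q(1) c, of j] q c by auto
  have decay: "b \<in> ?A \<longleftrightarrow> (\<exists>C. \<forall>j\<ge>1. ?x b j \<le> C \<and> ?y b j \<le> C)" for b
    by (simp only: mem_Collect_eq decay_iff_block_bounded[OF q(1) c])
  have "b \<in> ?A \<longleftrightarrow> bdd_above ((\<lambda>j. q powi (- (2 * int j * (2 * int j - 1))) *
        sqrt (\<Sum>l = 2 * j..2 * j + 1. (norm (b l))\<^sup>2 * (q ^ (4 * j - 1) / c) ^ (2 * l))) ` {1..})" for b
  proof -
    have "b \<in> ?A \<longleftrightarrow> bdd_above ((\<lambda>j. sqrt ((?x b j)\<^sup>2 + (?y b j)\<^sup>2)) ` {1..})"
      unfolding decay by (rule bounded_pairs_iff(3)) (rule nonneg)+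
    also have "(\<lambda>j. sqrt ((?x b j)\<^sup>2 + (?y b j)\<^sup>2)) ` {1..} =
        (\<lambda>j. q powi (- (2 * int j * (2 * int j - 1))) *
          sqrt (\<Sum>l = 2 * j..2 * j + 1. (norm (b l))\<^sup>2 * (q ^ (4 * j - 1) / c) ^ (2 * l))) ` {1..}"
      by (intro image_cong refl block_sqrt_eq[symmetric] q c) simp
    finally show ?thesis .
  qed
  moreover have "b \<in> ?A \<longleftrightarrow> (\<exists>D\<ge>1. \<forall>j\<ge>1.
        (norm (b (2 * j)))\<^sup>2 + (norm (b (2 * j + 1)))\<^sup>2 * (q ^ (2 * (4 * j - 1)) / c\<^sup>2)
        \<le> D\<^sup>2 * c ^ (4 * j) * q powi (- (8 * (int j)\<^sup>2)))" for b
    unfolding decay block_squares_le_iff[OF q(1) c] by (rule bounded_pairs_iff(2)) (rule nonneg)+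
  moreover have "b \<in> ?A \<longleftrightarrow> (\<exists>D\<ge>1. \<forall>j\<ge>1.
        norm (b (2 * j)) + norm (b (2 * j + 1)) * (q ^ (4 * j - 1) / c)
        \<le> D * c ^ (2 * j) * q powi (- (4 * (int j)\<^sup>2)))" for b
    unfolding decay block_sum_le_iff[OF q(1) c] by (rule bounded_pairs_iff(1)) (rule nonneg)+
  ultimately show ?thesis
    unfolding space solid by (intro conjI set_eqI) (simp_all only: mem_Collect_eq)
qed

end
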